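(* Consider the heterogeneous data-center right-sizing problem with time-independent operating cost functions, i.e. $f_{t,j}=f_j$ for all $t\in[T]$, $j\in[d]$, where $f_j(0)>0$ for all $j$. Then the online algorithm $\mathcal{A}$ described below is $(2d+1)$-competitive: for every such instance, $C(X^{\mathcal A})\le (2d+1)\cdot C(X^\ast)$, where $X^{\mathcal A}$ is the schedule produced by $\mathcal A$ and $X^\ast$ is an optimal schedule.
   Context: Notation: $[k]=\{1,\dots,k\}$, $[k]_0=\{0,\dots,k\}$, $(x)^+=\max(x,0)$. Problem: An instance consists of $T\in\mathbb N$ time slots, $d\in\mathbb N$ server types, numbers $m_1,\dots,m_d\in\mathbb N$ of servers of each type, switching costs $\beta_j>0$, capacities $z^{\max}_j>0$, job volumes $\lambda_t\ge 0$ ($t\in[T]$), and operating cost functions $f_{t,j}$ ($t\in[T]$, $j\in[d]$) that are convex, increasing and non-negative on $[0,z^{\max}_j]$ (taking the value $+\infty$ for loads above $z^{\max}_j$); $f_{t,j}(z)$ is the cost of one server of type $j$ running with load $z$ in slot $t$. For $x\in\mathbb N_0$, $z\in[0,1]$ put $g_{t,j}(x,z)=x f_{t,j}(\lambda_t z/x)$ if $x>0$, $g_{t,j}(0,z)=\infty$ if $\lambda_t z>0$, and $g_{t,j}(0,z)=0$ if $\lambda_t z=0$. Let $\mathcal Z=\{(z_1,\dots,z_d)\in[0,1]^d:\sum_j z_j=1\}$ and $g_t(x_1,\dots,x_d)=\min_{(z_1,\dots,z_d)\in\mathcal Z}\sum_{j=1}^d g_{t,j}(x_j,z_j)$. A schedule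 is $X=(\vec x_1,\dots,\vec x_T)$ with $\vec x_t=(x_{t,1},\dots,x_{t,d})$, $x_{t,j}\in[m_j]_0$, and the convention $\vec x_0=\vec x_{T+1}=\vec 0$; it is feasible if moreover $\sum_j x_{t,j}z^{\max}_j\ge\lambda_t$ for all $t$. Its cost is $C(X)=\sum_{t=1}^T\big(g_t(\vec x_t)+\sum_{j=1}^d\beta_j(x_{t,j}-x_{t-1,j})^+\big)$. An optimal schedule is a feasible schedule of minimum cost. Online setting: $T,d,\vec m,\vec\beta$ are known; at slot $t$ the algorithm learns $\lambda_t$ and $f_{t,1},\dots,f_{t,d}$ and must fix $\vec x_t$ without knowledge of later slots. A deterministic online algorithm is $c$-competitive if on every instance its cost is at most $c$ times the optimal cost. Truncated instances: for $t\in[T]$, $\mathcal I^t$ is the instance with only slots $1,\dots,t$ (same other data, final state $\vec x_{t+1}=\vec 0$); $\hat X^t$ denotes an optimal schedule for $\mathcal I^t$, with entries $\hat x^t_{u,j}$. Algorithm $\mathcal A$ (for $f_{t,j}=f_j$ with $f_j(0)>0$): let $\bar t_j=\lceil\beta_j/f_j(0)\rceil$. Initialize $w_{t,j}=0$ for all $t\in\mathbb Z$, $j\in[d]$, and $x^{\mathcal A}_{0,j}=0$. For $t=1,\dots,T$: compute $\hat X^t$; for each $j\in[d]$ set $x^{\mathcal A}_{t,j}:=x^{\mathcal A}_{t-1,j}-w_{t-\bar t_j,j}$ (the servers powered up at slot $t-\bar t_j$ are powered down); if $x^{\mathcal A}_{t,j}\le\hat x^t_{t,j}$, set $w_{t,j}:=\hat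 x^t_{t,j}-x^{\mathcal A}_{t,j}$ and $x^{\mathcal A}_{t,j}:=\hat x^t_{t,j}$. The output is $X^{\mathcal A}=(\vec x^{\mathcal A}_1,\dots,\vec x^{\mathcal A}_T)$. *)

theory Defs
  imports "HOL-Analysis.Analysis"
begin

text \<open>Time slots are indexed by \<open>1..horizon\<close> and server types by \<open>1..num_types\<close>; values of the
  functions below at other indices are never used.  The cost function \<open>opcost I t j\<close> is only
  meaningful on \<open>[0, zmax I j]\<close>; its extension by infinity is \<open>load_cost\<close>.\<close>

record dc_instance =
  horizon :: nat
  num_types :: nat
  servers :: "nat \<Rightarrow> nat"
  swcost :: "nat \<Rightarrow> real"
  zmax :: "nat \<Rightarrow> real"
  volume :: "nat \<Rightarrow> real"
  opcost :: "nat \<Rightarrow> nat \<Rightarrow> real \<Rightarrow> real"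

type_synonym schedule = "nat \<Rightarrow> nat \<Rightarrow> nat"

definition valid_instance :: "dc_instance \<Rightarrow> bool" where
  "valid_instance I \<longleftrightarrow>
     horizon I \<ge> 1 \<and> num_types I \<ge> 1 \<and>
     (\<forall>j\<in>{1..num_types I}. servers I j \<ge> 1 \<and> swcost I j > 0 \<and> zmax I j > 0) \<and>
     (\<forall>t\<in>{1..horizon I}. volume I t \<ge> 0) \<and>
     (\<forall>t\<in>{1..horizon I}. \<forall>j\<in>{1..num_types I}.
        convex_on {0..zmax I j} (opcost I t j) \<and>
        mono_on {0..zmax I j} (opcost I t j) \<and>
        (\<forall>z\<in>{0..zmax I j}. opcost I t j z \<ge> 0))"

definition load_cost :: "dc_instance \<Rightarrow> nat \<Rightarrow> nat \<Rightarrow> real \<Rightarrow> ereal" where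
  "load_cost I t j z = (if z \<le> zmax I j then ereal (opcost I t j z) else \<infinity>)"

definition type_cost :: "dc_instance \<Rightarrow> nat \<Rightarrow> nat \<Rightarrow> nat \<Rightarrow> real \<Rightarrow> ereal" where
  "type_cost I t j x z =
     (if x > 0 then ereal (real x) * load_cost I t j (volume I t * z / real x)
      else if volume I t * z > 0 then \<infinity> else 0)"

definition load_splits :: "dc_instance \<Rightarrow> (nat \<Rightarrow> real) set" where
  "load_splits I =
     {z. (\<forall>j\<in>{1..num_types I}. z j \<in> {0..1}) \<and> (\<Sum>j=1..num_types I. z j) = 1}"

text \<open>The minimum over all load splits is rendered as an infimum: a convex increasing function on
  \<open>[0, zmax]\<close> may jump upwards at \<open>zmax\<close>, in which case the minimum need not be attained.\<close>

definition slot_cost :: "dc_instance \<Rightarrow> nat \<Rightarrow> (nat \<Rightarrow> nat) \<Rightarrow> ereal" where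
  "slot_cost I t x = (INF z\<in>load_splits I. \<Sum>j=1..num_types I. type_cost I t j (x j) (z j))"

text \<open>The convention that all servers are switched off before the first and after the last slot.\<close>

definition entry :: "dc_instance \<Rightarrow> schedule \<Rightarrow> nat \<Rightarrow> nat \<Rightarrow> nat" where
  "entry I X t j = (if t \<in> {1..horizon I} then X t j else 0)"

definition total_cost :: "dc_instance \<Rightarrow> schedule \<Rightarrow> ereal" where
  "total_cost I X =
     (\<Sum>t=1..horizon I. slot_cost I t (entry I X t) +
        (\<Sum>j=1..num_types I.
           ereal (swcost I j * max (real (entry I X t j) - real (entry I X (t - 1) j)) 0)))"

definition feasible :: "dc_instance \<Rightarrow> schedule \<Rightarrow> bool" where
  "feasible I X \<longleftrightarrow>
     (\<forall>t\<in>{1..horizon I}.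
        (\<forall>j\<in>{1..num_types I}. X t j \<le> servers I j) \<and>
        (\<Sum>j=1..num_types I. real (X t j) * zmax I j) \<ge> volume I t)"

definition optimal :: "dc_instance \<Rightarrow> schedule \<Rightarrow> bool" where
  "optimal I X \<longleftrightarrow> feasible I X \<and> (\<forall>Y. feasible I Y \<longrightarrow> total_cost I X \<le> total_cost I Y)"

definition truncated :: "dc_instance \<Rightarrow> nat \<Rightarrow> dc_instance" where
  "truncated I t = I\<lparr>horizon := t\<rparr>"

definition run_time :: "dc_instance \<Rightarrow> (nat \<Rightarrow> real \<Rightarrow> real) \<Rightarrow> nat \<Rightarrow> nat" where
  "run_time I f j = nat \<lceil>swcost I j / f j 0\<rceil>"

text \<open>State of the algorithm after slot \<open>t\<close>: the current configuration and the array \<open>w\<close> of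
  numbers of servers powered up so far.  \<open>Xh t\<close> is the optimal schedule used for the instance
  truncated after slot \<open>t\<close>.  The subtraction on natural numbers is never truncated,
  see \<open>alg_w_le\<close>.\<close>

primrec alg_state ::
  "dc_instance \<Rightarrow> (nat \<Rightarrow> real \<Rightarrow> real) \<Rightarrow> (nat \<Rightarrow> schedule) \<Rightarrow> nat
     \<Rightarrow> (nat \<Rightarrow> nat) \<times> (int \<Rightarrow> nat \<Rightarrow> nat)" where
  "alg_state I f Xh 0 = ((\<lambda>j. 0), (\<lambda>u j. 0))"
| "alg_state I f Xh (Suc n) =
     (let t = Suc n;
          (x, w) = alg_state I f Xh n;
          y = (\<lambda>j. x j - w (int t - int (run_time I f j)) j);
          xh = Xh t t
      in ((\<lambda>j. if y j \<le> xh j then xh j else y j),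
          w(int t := (\<lambda>j. if y j \<le> xh j then xh j - y j else w (int t) j))))"

definition alg_schedule ::
  "dc_instance \<Rightarrow> (nat \<Rightarrow> real \<Rightarrow> real) \<Rightarrow> (nat \<Rightarrow> schedule) \<Rightarrow> schedule" where
  "alg_schedule I f Xh t = fst (alg_state I f Xh t)"

lemma alg_state_online:
  assumes "\<And>u. u \<in> {1..t} \<Longrightarrow> Xh u u = Xh' u u"
  shows "alg_state I f Xh t = alg_state I f Xh' t"
  using assms
proof (induction t)
  case (Suc n)
  have "alg_state I f Xh n = alg_state I f Xh' n" "Xh (Suc n) (Suc n) = Xh' (Suc n) (Suc n)"
    using Suc by auto
  thus ?case by (simp only: alg_state.simps Let_def)
qed simp

lemma alg_w_outside: "u \<le> 0 \<or> u > int t \<Longrightarrow> snd (alg_state I f Xh t) u j = 0"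
  by (induction t) (auto simp: Let_def split: prod.splits)

lemma alg_x_eq_sum:
  assumes "run_time I f j \<ge> 1"
  shows "fst (alg_state I f Xh t) j
         = (\<Sum>u\<in>{int t - int (run_time I f j)<..int t}. snd (alg_state I f Xh t) u j)"
proof (induction t)
  case 0
  show ?case by simp
next
  case (Suc n)
  define r where "r = int (run_time I f j)"
  have r: "r \<ge> 1" using assms by (simp add: r_def)
  obtain x w where xw: "alg_state I f Xh n = (x, w)" by (cases "alg_state I f Xh n")
  have w0: "w (int n + 1) j = 0"
    using alg_w_outside[of "int n + 1" n I f Xh j] xw by simp
  define S where "S = (\<Sum>u\<in>{int n + 1 - r<..int n}. w u j)"
  have x: "x j = (\<Sum>u\<in>{int n - r<..int n}. w u j)"
    using Suc xw by (simp add: r_def)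
  have "{int n - r<..int n} = insert (int n + 1 - r) {int n + 1 - r<..int n}"
    using r by auto
  hence xS: "x j = w (int n + 1 - r) j + S"
    unfolding x S_def by simp
  define w' where "w' = snd (alg_state I f Xh (Suc n))"
  have w': "w' u j = (if u = int n + 1 then Xh (Suc n) (Suc n) j - S else w u j)" for u
    using xw xS w0 by (auto simp: w'_def Let_def r_def algebra_simps)
  have "{int n + 1 - r<..int n + 1} = insert (int n + 1) {int n + 1 - r<..int n}"
    using r by auto
  hence "(\<Sum>u\<in>{int n + 1 - r<..int n + 1}. w' u j)
         = (Xh (Suc n) (Suc n) j - S) + (\<Sum>u\<in>{int n + 1 - r<..int n}. w' u j)"
    by (simp add: w')
  also have "(\<Sum>u\<in>{int n + 1 - r<..int n}. w' u j) = S"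
    unfolding S_def by (rule sum.cong) (auto simp: w')
  finally have "(\<Sum>u\<in>{int n + 1 - r<..int n + 1}. w' u j) = max (Xh (Suc n) (Suc n) j) S"
    by simp
  moreover have "fst (alg_state I f Xh (Suc n)) j = max (Xh (Suc n) (Suc n) j) S"
    using xw xS by (auto simp: Let_def r_def algebra_simps)
  ultimately show ?case by (simp add: w'_def r_def add.commute)
qed

lemma alg_w_le:
  assumes "run_time I f j \<ge> 1"
  shows "snd (alg_state I f Xh n) (int (Suc n) - int (run_time I f j)) j
         \<le> fst (alg_state I f Xh n) j"
  unfolding alg_x_eq_sum[OF assms]
  by (rule member_le_sum) (use assms in auto)

lemma alg_schedule_feasible:
  assumes "valid_instance I"
    and "\<And>t. t \<in> {1..horizon I} \<Longrightarrow> optimal (truncated I t) (Xh t)"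
  shows "feasible I (alg_schedule I f Xh)"
proof -
  have Xh: "Xh t t j \<le> servers I j" "(\<Sum>j=1..num_types I. real (Xh t t j) * zmax I j) \<ge> volume I t"
    if "t \<in> {1..horizon I}" "j \<in> {1..num_types I}" for t j
    using assms(2)[OF that(1)] that by (auto simp: optimal_def feasible_def truncated_def)
  have ge: "Xh t t j \<le> alg_schedule I f Xh t j" if "t \<ge> 1" for t j
    using that by (cases t) (auto simp: alg_schedule_def Let_def split: prod.splits)
  have le: "t \<le> horizon I \<Longrightarrow> alg_schedule I f Xh t j \<le> servers I j"
    if "j \<in> {1..num_types I}" for t j
  proof (induction t)
    case (Suc n)
    show ?case
      using Suc Xh(1)[of "Suc n" j] that
      by (auto simp: alg_schedule_def Let_def split: prod.splits)
  qed (simp add: alg_schedule_def)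
  have "1 \<in> {1..num_types I}" using assms(1) by (auto simp: valid_instance_def)
  have "(\<Sum>j=1..num_types I. real (alg_schedule I f Xh t j) * zmax I j) \<ge> volume I t"
    if t: "t \<in> {1..horizon I}" for t
  proof -
    have "volume I t \<le> (\<Sum>j=1..num_types I. real (Xh t t j) * zmax I j)"
      using Xh(2)[OF t] \<open>1 \<in> {1..num_types I}\<close> by blast
    also have "\<dots> \<le> (\<Sum>j=1..num_types I. real (alg_schedule I f Xh t j) * zmax I j)"
      using assms(1) t ge
      by (intro sum_mono mult_right_mono) (auto simp: valid_instance_def less_imp_le)
    finally show ?thesis .
  qed
  thus ?thesis using le by (auto simp: feasible_def)
qed

end

theory Submission
  imports Defs
begin

text \<open>Write \<open>OPT n\<close> for the optimal cost of the instance truncated after slot \<open>n\<close>.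
  Cutting \<open>Xh n\<close> after slot \<open>m\<close> gives a feasible schedule for the shorter instance, so \<open>OPT n\<close>
  is at least \<open>OPT m\<close> plus what \<open>Xh n\<close> pays in the slots after \<open>m\<close>.

  For \<open>m = n - 1\<close> this shows that the operating costs of the configurations \<open>Xh t t\<close> sum up to at
  most \<open>OPT T\<close>; by convexity, every additional server of type \<open>j\<close> that the algorithm keeps
  running costs at most \<open>f j 0\<close> per slot.

  For \<open>m = n - r\<close> with \<open>r\<close> the running time of type \<open>j\<close>, each of the \<open>Xh n n j\<close> servers of
  the last slot was either powered up after slot \<open>m\<close> or idled for \<open>r\<close> slots, which costs at least
  \<open>\<beta>\<^sub>j\<close> either way.  If the algorithm powers up servers at slot \<open>n\<close>, then \<open>Xh n n j\<close> is the number
  of servers it powered up in the last \<open>r\<close> slots; hence \<open>\<beta>\<^sub>j\<close> times the number of all power-ups of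
  type \<open>j\<close> is at most \<open>OPT T\<close>.  A power-up causes switching cost \<open>\<beta>\<^sub>j\<close> and idle cost
  \<open>(r - 1) * f j 0 \<le> \<beta>\<^sub>j\<close> besides the slot already accounted for, so each type contributes at
  most \<open>2 * OPT T\<close>.\<close>

section \<open>Costs of prefixes and truncated instances\<close>

text \<open>Unlike \<open>entry\<close>, this does not depend on the horizon, so truncated instances
  with different horizons share the same summands \<open>step_cost I X t\<close>.\<close>

definition config :: "schedule \<Rightarrow> nat \<Rightarrow> nat \<Rightarrow> nat" where
  "config X t j = (if t = 0 then 0 else X t j)"

definition step_cost :: "dc_instance \<Rightarrow> schedule \<Rightarrow> nat \<Rightarrow> ereal" where
  "step_cost I X t = slot_cost I t (config X t) +
     (\<Sum>j=1..num_types I.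
        ereal (swcost I j * max (real (config X t j) - real (config X (t - 1) j)) 0))"

definition prefix_cost :: "dc_instance \<Rightarrow> schedule \<Rightarrow> nat \<Rightarrow> ereal" where
  "prefix_cost I X n = (\<Sum>t=1..n. step_cost I X t)"

lemma slot_cost_truncated: "slot_cost (truncated I n) = slot_cost I"
proof -
  have "num_types (truncated I n) = num_types I" "volume (truncated I n) = volume I"
    "load_cost (truncated I n) = load_cost I"
    by (simp_all add: truncated_def load_cost_def fun_eq_iff)
  then show ?thesis
    unfolding slot_cost_def[abs_def] load_splits_def type_cost_def by (simp only:)
qed

lemma total_cost_truncated: "total_cost (truncated I n) X = prefix_cost I X n"
proof -
  have h: "horizon (truncated I n) = n" "num_types (truncated I n) = num_types I"
    "swcost (truncated I n) = swcost I"
    by (simp_all add: truncated_def)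
  have e: "entry (truncated I n) X t = config X t" if "t \<le> n" for t
    using that by (auto simp: fun_eq_iff entry_def config_def h)
  show ?thesis
    unfolding total_cost_def prefix_cost_def step_cost_def h slot_cost_truncated
    by (intro sum.cong refl) (auto simp: e le_diff_conv simp del: sum_ereal)
qed

lemma truncated_horizon: "truncated I (horizon I) = I"
  by (simp add: truncated_def)

lemma feasible_truncated_mono:
  "feasible (truncated I n) X \<Longrightarrow> m \<le> n \<Longrightarrow> feasible (truncated I m) X"
  by (auto simp: feasible_def truncated_def)

lemma prefix_cost_split:
  "prefix_cost I X (m + k) = prefix_cost I X m + (\<Sum>t=Suc m..m + k. step_cost I X t)"
  by (induction k) (simp_all add: prefix_cost_def add.assoc)

section \<open>Two inequalities over the reals\<close>

text \<open>The load \<open>v / (x + k)\<close> is the convex combination of \<open>v / x\<close>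
  and 0 with weights \<open>x / (x + k)\<close> and \<open>k / (x + k)\<close>: sharing the work
  with \<open>k\<close> more servers is no worse than leaving them idle.\<close>

lemma perspective_convex_bound:
  fixes f :: "real \<Rightarrow> real"
  assumes f: "convex_on {0..b} f" and v: "0 \<le> v" "v / x \<le> b" and x: "0 < x" and k: "0 \<le> k"
  shows "(x + k) * f (v / (x + k)) \<le> x * f (v / x) + k * f 0"
proof -
  have "0 \<le> v / x" using v x by simp
  then have "v / x \<in> {0..b}" "0 \<in> {0..b}" using v by auto
  moreover have "0 \<le> x / (x + k)" "0 \<le> k / (x + k)" "x / (x + k) + k / (x + k) = 1"
    using x k by (auto simp flip: add_divide_distrib)
  ultimately have "f ((x / (x + k)) *\<^sub>R (v / x) + (k / (x + k)) *\<^sub>R 0)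
      \<le> x / (x + k) * f (v / x) + k / (x + k) * f 0"
    using f unfolding convex_on_def by blast
  then have "f (v / (x + k)) \<le> (x * f (v / x) + k * f 0) / (x + k)"
    using x by (simp add: add_divide_distrib)
  then show ?thesis
    using x k by (simp add: field_simps)
qed

text \<open>The number \<open>a\<close> is what each server running at the start of the window has already paid;
  \<open>a = c\<close> is the right choice if there are none.\<close>

lemma window_cost_bound:
  fixes x :: "nat \<Rightarrow> real"
  assumes x: "\<And>t. 0 \<le> x t" and a: "0 \<le> a" "a \<le> c" and e: "0 \<le> e"
  shows "min c (a + real k * e) * x (m + k)
    \<le> a * x m + (\<Sum>t=Suc m..m + k. x t * e + c * max (x t - x (t - 1)) 0)"
proof (induction k)
  case 0
  then show ?case using a by simp
next
  case (Suc k)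
  define p q b where "p = x (m + k)" and "q = x (Suc (m + k))" and "b = min c (a + real k * e)"
  have b: "0 \<le> b" "b \<le> c" "min c (a + real (Suc k) * e) \<le> b + e"
    using a e by (auto simp: b_def min_def algebra_simps)
  have pq: "0 \<le> p" "0 \<le> q" using x by (auto simp: p_def q_def)
  have "min c (a + real (Suc k) * e) * q \<le> (b + e) * q"
    using b pq by (intro mult_right_mono) auto
  also have "\<dots> = b * p + b * (q - p) + q * e"
    by (simp add: algebra_simps)
  \<comment> \<open>Each additional server pays \<open>c\<close>, which is at least
    \<open>b\<close>; if servers are shut down, the left side is at most 0.\<close>
  also have "b * (q - p) \<le> c * max (q - p) 0"
  proof (cases "p \<le> q")
    case True
    then show ?thesis using b by (simp add: mult_right_mono)
  next
    case False
    then show ?thesis using b by (simp add: mult_nonneg_nonpos)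
  qed
  finally show ?case
    using Suc by (simp add: p_def q_def b_def)
qed

section \<open>The instance and its basic data\<close>

locale right_sizing =
  fixes I :: dc_instance and f :: "nat \<Rightarrow> real \<Rightarrow> real" and Xh :: "nat \<Rightarrow> schedule"
  assumes valid: "valid_instance I"
    and opcost_eq: "\<And>t j z. t \<in> {1..horizon I} \<Longrightarrow> j \<in> {1..num_types I} \<Longrightarrow>
      z \<in> {0..zmax I j} \<Longrightarrow> opcost I t j z = f j z"
    and idle_pos: "\<And>j. j \<in> {1..num_types I} \<Longrightarrow> f j 0 > 0"
    and Xh_optimal: "\<And>t. t \<in> {1..horizon I} \<Longrightarrow> optimal (truncated I t) (Xh t)"
begin

abbreviation "types \<equiv> {1..num_types I}"
abbreviation "OPT n \<equiv> prefix_cost I (Xh n) n"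
abbreviation "alg \<equiv> alg_schedule I f Xh"
abbreviation "rt \<equiv> run_time I f"

definition powered_up :: "nat \<Rightarrow> nat \<Rightarrow> nat" where
  "powered_up t j = snd (alg_state I f Xh t) (int t) j"

lemma swcost_pos: "j \<in> types \<Longrightarrow> swcost I j > 0"
  and zmax_pos: "j \<in> types \<Longrightarrow> zmax I j > 0"
  and volume_nonneg: "t \<in> {1..horizon I} \<Longrightarrow> volume I t \<ge> 0"
  using valid by (auto simp: valid_instance_def)

lemma swcost_nonneg: "j \<in> types \<Longrightarrow> swcost I j \<ge> 0"
  and idle_nonneg: "j \<in> types \<Longrightarrow> f j 0 \<ge> 0"
  using swcost_pos idle_pos by (auto simp: less_imp_le)

lemma opcost_convex:
  "t \<in> {1..horizon I} \<Longrightarrow> j \<in> types \<Longrightarrow> convex_on {0..zmax I j} (opcost I t j)"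
  and opcost_mono:
  "t \<in> {1..horizon I} \<Longrightarrow> j \<in> types \<Longrightarrow> mono_on {0..zmax I j} (opcost I t j)"
  using valid by (auto simp: valid_instance_def)

lemma opcost_0: "t \<in> {1..horizon I} \<Longrightarrow> j \<in> types \<Longrightarrow> opcost I t j 0 = f j 0"
  using zmax_pos[of j] by (intro opcost_eq) auto

section \<open>Idle cost as a bound for operating costs\<close>

lemma type_cost_lower:
  assumes t: "t \<in> {1..horizon I}" and j: "j \<in> types" and z: "0 \<le> z"
  shows "ereal (real x * f j 0) \<le> type_cost I t j x z"
proof (cases "x > 0 \<and> volume I t * z / real x \<le> zmax I j")
  case True
  have "0 \<le> volume I t * z / real x" using volume_nonneg[OF t] z by simp
  then have "opcost I t j 0 \<le> opcost I t j (volume I t * z / real x)"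
    using True zmax_pos[OF j] by (intro mono_onD[OF opcost_mono[OF t j]]) auto
  then show ?thesis
    using True by (simp add: type_cost_def load_cost_def opcost_0[OF t j])
qed (auto simp: type_cost_def load_cost_def)

lemma type_cost_add:
  assumes t: "t \<in> {1..horizon I}" and j: "j \<in> types" and z: "0 \<le> z"
  shows "type_cost I t j (x + k) z \<le> type_cost I t j x z + ereal (real k * f j 0)"
proof -
  define v where "v = volume I t * z"
  have v: "0 \<le> v" using volume_nonneg[OF t] z by (simp add: v_def)
  \<comment> \<open>An admissible load on running servers needs convexity; without servers and work
    the \<open>k\<close> servers only idle; otherwise the right side is infinite.\<close>
  consider (pos) "x > 0" "v / real x \<le> zmax I j" | (zero) "x = 0" "v = 0"
    | (inf) "type_cost I t j x z = \<infinity>"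
    using v by (cases "x > 0"; cases "v = 0"; cases "v / real x \<le> zmax I j")
      (auto simp: type_cost_def load_cost_def v_def[symmetric])
  then show ?thesis
  proof cases
    case pos
    have "v / (real x + real k) \<le> v / real x"
      using pos v by (intro divide_left_mono) auto
    then have "v / (real x + real k) \<le> zmax I j" using pos by simp
    then show ?thesis
      using pos perspective_convex_bound[OF opcost_convex[OF t j] v pos(2), of "real k"]
      by (simp add: type_cost_def load_cost_def v_def[symmetric] opcost_0[OF t j])
  next
    case zero
    then show ?thesis
      using zmax_pos[OF j] idle_pos[OF j]
      by (simp add: type_cost_def load_cost_def v_def[symmetric] opcost_0[OF t j])
  qed simp
qed

lemma slot_cost_lower:
  assumes t: "t \<in> {1..horizon I}"
  shows "ereal (\<Sum>j\<in>types. real (x j) * f j 0) \<le> slot_cost I t x"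
  unfolding slot_cost_def
proof (rule INF_greatest)
  fix z assume "z \<in> load_splits I"
  then show "ereal (\<Sum>j\<in>types. real (x j) * f j 0) \<le> (\<Sum>j\<in>types. type_cost I t j (x j) (z j))"
    unfolding sum_ereal[symmetric]
    by (intro sum_mono type_cost_lower[OF t]) (auto simp: load_splits_def)
qed

lemma slot_cost_le:
  assumes t: "t \<in> {1..horizon I}" and xy: "\<And>j. j \<in> types \<Longrightarrow> x j \<le> y j"
  shows "slot_cost I t y \<le> slot_cost I t x + ereal (\<Sum>j\<in>types. (real (y j) - real (x j)) * f j 0)"
proof -
  define c where "c = (\<Sum>j\<in>types. (real (y j) - real (x j)) * f j 0)"
  \<comment> \<open>The finite term moves to the left so that a bound for every split suffices, as
    the infimum need not be attained. Each split for \<open>x\<close> is kept for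
    \<open>y\<close>.\<close>
  have "slot_cost I t y - ereal c \<le> slot_cost I t x"
    unfolding slot_cost_def[of I t x]
  proof (rule INF_greatest)
    fix z assume z: "z \<in> load_splits I"
    have "slot_cost I t y \<le> (\<Sum>j\<in>types. type_cost I t j (y j) (z j))"
      unfolding slot_cost_def by (rule INF_lower[OF z])
    also have "\<dots> \<le> (\<Sum>j\<in>types. type_cost I t j (x j) (z j) + ereal ((real (y j) - real (x j)) * f j 0))"
    proof (rule sum_mono)
      fix j assume j: "j \<in> types"
      have "0 \<le> z j" using z j by (auto simp: load_splits_def)
      then show "type_cost I t j (y j) (z j)
          \<le> type_cost I t j (x j) (z j) + ereal ((real (y j) - real (x j)) * f j 0)"
        using type_cost_add[OF t j, of "z j" "x j" "y j - x j"] xy[OF j] by (simp add: of_nat_diff)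
    qed
    also have "\<dots> = (\<Sum>j\<in>types. type_cost I t j (x j) (z j)) + ereal c"
      by (simp add: sum.distrib c_def)
    finally show "slot_cost I t y - ereal c \<le> (\<Sum>j\<in>types. type_cost I t j (x j) (z j))"
      by (simp add: ereal_minus_le)
  qed
  then show ?thesis by (simp add: ereal_minus_le c_def)
qed

lemma slot_cost_nonneg:
  assumes "t \<in> {1..horizon I}"
  shows "0 \<le> slot_cost I t x"
proof -
  have "0 \<le> ereal (\<Sum>j\<in>types. real (x j) * f j 0)"
    using idle_nonneg by (auto intro!: sum_nonneg)
  then show ?thesis using slot_cost_lower[OF assms, of x] by (rule order_trans)
qed

lemma switching_nonneg:
  "0 \<le> (\<Sum>j\<in>types. ereal (swcost I j * max (real (a j) - real (b j)) 0))"
  using swcost_nonneg by (auto intro!: sum_nonneg)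

lemma step_cost_ge_slot_cost: "t \<in> {1..horizon I} \<Longrightarrow> slot_cost I t (X t) \<le> step_cost I X t"
proof -
  assume t: "t \<in> {1..horizon I}"
  have "config X t = X t" using t by (auto simp: config_def fun_eq_iff)
  then show ?thesis
    using add_left_mono[OF switching_nonneg[of "config X t" "config X (t - 1)"], of "slot_cost I t (X t)"]
    by (simp add: step_cost_def)
qed

lemma step_cost_nonneg: "t \<in> {1..horizon I} \<Longrightarrow> 0 \<le> step_cost I X t"
  using step_cost_ge_slot_cost slot_cost_nonneg order_trans by blast

text \<open>The other types contribute non-negative amounts. What remains for type \<open>j\<close>
  has the shape of a summand in \<open>window_cost_bound\<close>.\<close>

lemma step_cost_lower:
  assumes t: "t \<in> {1..horizon I}" and j: "j \<in> types"
  shows "ereal (real (config X t j) * f j 0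
      + swcost I j * max (real (config X t j) - real (config X (t - 1) j)) 0) \<le> step_cost I X t"
proof -
  let ?s = "\<lambda>j. swcost I j * max (real (config X t j) - real (config X (t - 1) j)) 0"
  have "real (config X t j) * f j 0 \<le> (\<Sum>j\<in>types. real (config X t j) * f j 0)"
    using idle_nonneg by (intro member_le_sum j mult_nonneg_nonneg) auto
  then have "ereal (real (config X t j) * f j 0) \<le> slot_cost I t (config X t)"
    using slot_cost_lower[OF t, of "config X t"] order_trans ereal_less_eq(3) by blast
  moreover have "?s j \<le> (\<Sum>j\<in>types. ?s j)"
    using swcost_nonneg by (intro member_le_sum j mult_nonneg_nonneg) auto
  ultimately show ?thesis
    unfolding step_cost_def sum_ereal plus_ereal.simps(1)[symmetric]
    by (intro add_mono) auto
qed

section \<open>Optimal costs of truncated instances\<close>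

lemma OPT_nonneg: "n \<le> horizon I \<Longrightarrow> 0 \<le> OPT n"
  unfolding prefix_cost_def by (intro sum_nonneg step_cost_nonneg) auto

lemma OPT_ge_OPT_add:
  assumes "m + k \<le> horizon I"
  shows "OPT m + (\<Sum>t=Suc m..m + k. step_cost I (Xh (m + k)) t) \<le> OPT (m + k)"
proof -
  have "OPT m \<le> prefix_cost I (Xh (m + k)) m"
  \<comment> \<open>\<open>Xh 0\<close> is not assumed optimal, but for \<open>m = 0\<close> both
    sides are empty sums.\<close>
  proof (cases "m = 0")
    case False
    then have "optimal (truncated I m) (Xh m)" "optimal (truncated I (m + k)) (Xh (m + k))"
      using assms by (auto intro!: Xh_optimal)
    then show ?thesis
      unfolding optimal_def total_cost_truncated[symmetric]
      using feasible_truncated_mono le_add1 by blast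
  qed (simp add: prefix_cost_def)
  then show ?thesis
    unfolding prefix_cost_split by (rule add_right_mono)
qed

lemma OPT_mono:
  assumes "m \<le> n" "n \<le> horizon I"
  shows "OPT m \<le> OPT n"
proof -
  obtain k where n: "n = m + k" using assms(1) le_Suc_ex by blast
  have "0 \<le> (\<Sum>t=Suc m..m + k. step_cost I (Xh (m + k)) t)"
    using assms n by (intro sum_nonneg step_cost_nonneg) auto
  then have "OPT m \<le> OPT m + (\<Sum>t=Suc m..m + k. step_cost I (Xh (m + k)) t)"
    by (metis add.right_neutral add_left_mono)
  also have "\<dots> \<le> OPT n"
    using OPT_ge_OPT_add[of m k] assms n by simp
  finally show ?thesis .
qed

lemma sum_slot_cost_le_OPT:
  "n \<le> horizon I \<Longrightarrow> (\<Sum>t=1..n. slot_cost I t (Xh t t)) \<le> OPT n"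
proof (induction n)
  case 0
  then show ?case by (simp add: prefix_cost_def)
next
  case (Suc n)
  have "(\<Sum>t=1..Suc n. slot_cost I t (Xh t t)) \<le> OPT n + step_cost I (Xh (Suc n)) (Suc n)"
    using Suc step_cost_ge_slot_cost[of "Suc n" "Xh (Suc n)"] by (auto intro!: add_mono)
  also have "\<dots> \<le> OPT (Suc n)"
    using OPT_ge_OPT_add[of n 1] Suc by simp
  finally show ?case .
qed

section \<open>Running times and windows of that length\<close>

lemma run_time_ge_1: "j \<in> types \<Longrightarrow> rt j \<ge> 1"
  using swcost_pos[of j] idle_pos[of j] by (simp add: run_time_def Suc_le_eq)

lemma swcost_le_run_time:
  assumes "j \<in> types"
  shows "swcost I j \<le> real (rt j) * f j 0"
proof -
  have "swcost I j / f j 0 \<le> real (rt j)"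
    unfolding run_time_def by linarith
  then show ?thesis using idle_pos[OF assms] by (simp add: field_simps)
qed

lemma run_time_le_swcost:
  assumes "j \<in> types"
  shows "(real (rt j) - 1) * f j 0 \<le> swcost I j"
proof -
  \<comment> \<open>Positivity ensures that \<open>nat\<close> leaves the rounded quotient
    unchanged.\<close>
  have "0 < swcost I j / f j 0" using swcost_pos idle_pos assms by simp
  then have "real (rt j) - 1 \<le> swcost I j / f j 0"
    unfolding run_time_def by linarith
  then show ?thesis using idle_pos[OF assms] by (simp add: field_simps)
qed

lemma OPT_window:
  assumes j: "j \<in> types" and n: "1 \<le> n" "n \<le> horizon I"
  shows "OPT (n - rt j) + ereal (swcost I j * real (Xh n n j)) \<le> OPT n"
proof -
  define m k where "m = n - rt j" and "k = n - m"
  have mk: "n = m + k" by (simp add: k_def m_def)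
  define x where "x = (\<lambda>t. real (config (Xh n) t j))"
  \<comment> \<open>For \<open>m = 0\<close> the window may be shorter than \<open>rt j\<close>, but
    no server runs at slot 0, so crediting each with \<open>swcost I j\<close> is free. Otherwise
    the window is full and idling through it alone pays for a server.\<close>
  define a where "a = (if m = 0 then swcost I j else 0)"
  have a: "0 \<le> a" "a \<le> swcost I j" "a * x m = 0"
    using swcost_pos[OF j] by (auto simp: a_def x_def config_def)
  have e: "0 \<le> f j 0" using idle_pos[OF j] by simp
  have "swcost I j \<le> a + real k * f j 0"
  proof (cases "m = 0")
    case False
    then have "k = rt j" by (auto simp: k_def m_def)
    then show ?thesis using swcost_le_run_time[OF j] a by simp
  qed (use e in \<open>simp add: a_def\<close>)
  then have "swcost I j * x n \<le> (\<Sum>t=Suc m..m + k. x t * f j 0 + swcost I j * max (x t - x (t - 1)) 0)"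
    using window_cost_bound[of x a "swcost I j" "f j 0" k m] a e
    by (simp only: mk[symmetric] min_absorb1) (simp add: x_def)
  moreover have "ereal (\<Sum>t=Suc m..m + k. x t * f j 0 + swcost I j * max (x t - x (t - 1)) 0)
      \<le> (\<Sum>t=Suc m..m + k. step_cost I (Xh (m + k)) t)"
    unfolding sum_ereal[symmetric] x_def mk
    by (intro sum_mono step_cost_lower j) (use n mk in auto)
  ultimately have "ereal (swcost I j * x n) \<le> (\<Sum>t=Suc m..m + k. step_cost I (Xh (m + k)) t)"
    using order_trans ereal_less_eq(3) by blast
  then have "OPT m + ereal (swcost I j * x n) \<le> OPT (m + k)"
    using OPT_ge_OPT_add[of m k] n mk add_left_mono order_trans by blast
  then show ?thesis
    using n by (simp only: mk[symmetric] x_def) (simp add: config_def m_def)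
qed

section \<open>Power-ups of the algorithm\<close>

lemma alg_w_eq_powered_up:
  "1 \<le> u \<Longrightarrow> u \<le> t \<Longrightarrow> snd (alg_state I f Xh t) (int u) j = powered_up u j"
proof (induction t)
  case (Suc t)
  then show ?case
    by (cases "u = Suc t") (auto simp: powered_up_def Let_def split: prod.splits)
qed simp

lemma alg_eq_sum_powered_up:
  assumes j: "j \<in> types"
  shows "alg t j = (\<Sum>u=Suc (t - rt j)..t. powered_up u j)"
proof -
  let ?w = "\<lambda>u. snd (alg_state I f Xh t) u j"
  have "alg t j = (\<Sum>u\<in>{int t - int (rt j)<..int t}. ?w u)"
    unfolding alg_schedule_def by (rule alg_x_eq_sum[OF run_time_ge_1[OF j]])
  \<comment> \<open>The integer window may reach below slot 1, where \<open>w\<close> vanishes;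
    truncated subtraction makes the natural window start at 1.\<close>
  also have "\<dots> = (\<Sum>u\<in>int ` {Suc (t - rt j)..t}. ?w u)"
  proof (rule sum.mono_neutral_right)
    show "\<forall>u\<in>{int t - int (rt j)<..int t} - int ` {Suc (t - rt j)..t}. ?w u = 0"
    proof
      fix u assume u: "u \<in> {int t - int (rt j)<..int t} - int ` {Suc (t - rt j)..t}"
      have "u \<le> 0"
      proof (rule ccontr)
        assume "\<not> u \<le> 0"
        then have "u = int (nat u)" "nat u \<in> {Suc (t - rt j)..t}" using u by auto
        then show False using u by blast
      qed
      then show "?w u = 0" by (simp add: alg_w_outside)
    qed
  qed auto
  also have "\<dots> = (\<Sum>u=Suc (t - rt j)..t. ?w (int u))"
    by (simp add: sum.reindex)
  also have "\<dots> = (\<Sum>u=Suc (t - rt j)..t. powered_up u j)"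
    by (intro sum.cong refl alg_w_eq_powered_up) auto
  finally show ?thesis .
qed

lemma alg_step:
  assumes "1 \<le> t"
  shows "Xh t t j \<le> alg t j"
    and "powered_up t j \<le> Xh t t j"
    and "alg t j \<le> alg (t - 1) j + powered_up t j"
    and "0 < powered_up t j \<Longrightarrow> alg t j = Xh t t j"
proof -
  obtain n where n: "t = Suc n" using assms by (cases t) auto
  obtain x w where xw: "alg_state I f Xh n = (x, w)" by fastforce
  \<comment> \<open>Slot \<open>t\<close> has not been written before, so its entry stays 0 unless
    servers are powered up.\<close>
  have w0: "w (int t) j = 0"
    using alg_w_outside[of "int t" n I f Xh j] by (simp add: xw n)
  define y where "y = x j - w (int t - int (rt j)) j"
  have "alg t j = (if y \<le> Xh t t j then Xh t t j else y)"
    "powered_up t j = (if y \<le> Xh t t j then Xh t t j - y else 0)"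
    "alg (t - 1) j = x j" "y \<le> x j"
    using w0 by (simp_all add: alg_schedule_def powered_up_def n xw Let_def y_def)
  then show "Xh t t j \<le> alg t j" "powered_up t j \<le> Xh t t j"
    "alg t j \<le> alg (t - 1) j + powered_up t j"
    "0 < powered_up t j \<Longrightarrow> alg t j = Xh t t j"
    by (auto split: if_splits)
qed

text \<open>The induction is strong because a slot with power-ups leads back by a whole window,
  whose power-ups are paid by \<open>OPT_window\<close>; a slot without any follows from
  \<open>OPT_mono\<close>.\<close>

lemma swcost_powered_up_le_OPT:
  assumes j: "j \<in> types"
  shows "n \<le> horizon I \<Longrightarrow> ereal (swcost I j * real (\<Sum>u=1..n. powered_up u j)) \<le> OPT n"
proof (induction n rule: less_induct)
  case (less n)
  consider "n = 0" | "1 \<le> n" "powered_up n j = 0" | "1 \<le> n" "0 < powered_up n j" by linarith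
  then show ?case
  proof cases
    case 1
    then show ?thesis by (simp add: prefix_cost_def)
  next
    case 2
    then have "(\<Sum>u=1..n. powered_up u j) = (\<Sum>u=1..n - 1. powered_up u j)"
      by (cases n) auto
    then have "ereal (swcost I j * real (\<Sum>u=1..n. powered_up u j)) \<le> OPT (n - 1)"
      using less 2 by simp
    also have "\<dots> \<le> OPT n" using less 2 by (intro OPT_mono) auto
    finally show ?thesis .
  next
    case 3
    define m where "m = n - rt j"
    have m: "m < n" using 3 run_time_ge_1[OF j] by (simp add: m_def)
    have "{1..n} = {1..m} \<union> {Suc m..n}" using m by auto
    then have "(\<Sum>u=1..n. powered_up u j) = (\<Sum>u=1..m. powered_up u j) + (\<Sum>u=Suc m..n. powered_up u j)"
      by (simp add: sum.union_disjoint)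
    \<comment> \<open>The window sum is \<open>alg n j\<close>, and a power-up at \<open>n\<close>
      forces this to equal \<open>Xh n n j\<close>.\<close>
    also have "(\<Sum>u=Suc m..n. powered_up u j) = Xh n n j"
      using alg_eq_sum_powered_up[OF j, of n] alg_step(4)[OF 3] by (simp add: m_def)
    finally have "ereal (swcost I j * real (\<Sum>u=1..n. powered_up u j))
        = ereal (swcost I j * real (\<Sum>u=1..m. powered_up u j)) + ereal (swcost I j * real (Xh n n j))"
      by (simp add: algebra_simps)
    also have "\<dots> \<le> OPT m + ereal (swcost I j * real (Xh n n j))"
      using less m by (intro add_right_mono) auto
    also have "\<dots> \<le> OPT n"
      unfolding m_def using OPT_window[OF j] 3 less by blast
    finally show ?thesis .
  qed
qed

section \<open>Cost of the algorithm\<close>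

lemma sum_alg_le:
  assumes j: "j \<in> types"
  shows "(\<Sum>t=1..n. alg t j) \<le> rt j * (\<Sum>u=1..n. powered_up u j)"
proof -
  let ?B = "SIGMA t:{1..n}. {Suc (t - rt j)..t}" and ?C = "SIGMA u:{1..n}. {u..<u + rt j}"
  have "(\<Sum>t=1..n. alg t j) = (\<Sum>(t, u)\<in>?B. powered_up u j)"
    by (simp add: alg_eq_sum_powered_up[OF j] sum.Sigma)
  also have "\<dots> = (\<Sum>(u, t)\<in>prod.swap ` ?B. powered_up u j)"
    by (subst sum.reindex) (auto simp: case_prod_unfold)
  \<comment> \<open>Double counting by power-up slot \<open>u\<close>; the larger set also counts
    running slots after \<open>n\<close>.\<close>
  also have "\<dots> \<le> (\<Sum>(u, t)\<in>?C. powered_up u j)"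
    by (rule sum_mono2) auto
  also have "\<dots> = (\<Sum>u=1..n. \<Sum>t\<in>{u..<u + rt j}. powered_up u j)"
    by (subst sum.Sigma) auto
  finally show ?thesis by (simp add: sum_distrib_left)
qed

lemma type_overhead_le:
  assumes j: "j \<in> types"
  shows "(\<Sum>t=1..n. (real (alg t j) - real (Xh t t j)) * f j 0 + swcost I j * real (powered_up t j))
    \<le> 2 * (swcost I j * real (\<Sum>u=1..n. powered_up u j))"
proof -
  define P where "P = real (\<Sum>u=1..n. powered_up u j)"
  \<comment> \<open>Each power-up at \<open>t\<close> is part of \<open>Xh t t j\<close>, which
    removes one running slot per power-up. This gives \<open>rt j - 1\<close> below, and
    \<open>run_time_le_swcost\<close> applies.\<close>
  have "(\<Sum>t=1..n. real (alg t j) - real (Xh t t j)) \<le> (\<Sum>t=1..n. real (alg t j) - real (powered_up t j))"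
    using alg_step(2) by (intro sum_mono) auto
  also have "\<dots> = real (\<Sum>t=1..n. alg t j) - P"
    by (simp add: sum_subtractf P_def)
  also have "\<dots> \<le> (real (rt j) - 1) * P"
  proof -
    have "real (\<Sum>t=1..n. alg t j) \<le> real (rt j) * P"
      unfolding P_def of_nat_mult[symmetric] of_nat_le_iff by (rule sum_alg_le[OF j])
    then show ?thesis by (simp add: algebra_simps)
  qed
  finally have "(\<Sum>t=1..n. real (alg t j) - real (Xh t t j)) * f j 0 \<le> (real (rt j) - 1) * P * f j 0"
    using idle_pos[OF j] by (intro mult_right_mono) auto
  also have "\<dots> = (real (rt j) - 1) * f j 0 * P" by simp
  also have "\<dots> \<le> swcost I j * P"
    by (intro mult_right_mono run_time_le_swcost j) (simp add: P_def del: of_nat_sum)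
  finally show ?thesis
    by (simp add: sum.distrib P_def flip: sum_distrib_left sum_distrib_right)
qed

lemma step_cost_alg_le:
  assumes t: "t \<in> {1..horizon I}"
  shows "step_cost I alg t \<le> slot_cost I t (Xh t t) + ereal (\<Sum>j\<in>types.
    (real (alg t j) - real (Xh t t j)) * f j 0 + swcost I j * real (powered_up t j))"
proof -
  have c: "config alg s = alg s" for s
    by (auto simp: config_def fun_eq_iff alg_schedule_def)
  have "slot_cost I t (alg t)
      \<le> slot_cost I t (Xh t t) + ereal (\<Sum>j\<in>types. (real (alg t j) - real (Xh t t j)) * f j 0)"
    using t by (intro slot_cost_le alg_step(1)) auto
  \<comment> \<open>Switching costs count the net increase only, so servers shut down in the same
    slot can only lower them.\<close>
  moreover have "(\<Sum>j\<in>types. swcost I j * max (real (alg t j) - real (alg (t - 1) j)) 0)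
      \<le> (\<Sum>j\<in>types. swcost I j * real (powered_up t j))"
  proof (intro sum_mono mult_left_mono)
    fix j assume "j \<in> types"
    show "max (real (alg t j) - real (alg (t - 1) j)) 0 \<le> real (powered_up t j)"
      using alg_step(3)[of t j] t by auto
    show "0 \<le> swcost I j" using swcost_pos[OF \<open>j \<in> types\<close>] by simp
  qed
  ultimately have "step_cost I alg t
      \<le> (slot_cost I t (Xh t t) + ereal (\<Sum>j\<in>types. (real (alg t j) - real (Xh t t j)) * f j 0))
        + ereal (\<Sum>j\<in>types. swcost I j * real (powered_up t j))"
    unfolding step_cost_def c sum_ereal by (intro add_mono) auto
  then show ?thesis by (simp add: sum.distrib add.assoc)
qed

lemma alg_competitive:
  "total_cost I alg \<le> ereal (2 * real (num_types I) + 1) * OPT (horizon I)"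
proof -
  define T where "T = horizon I"
  let ?h = "\<lambda>t j. (real (alg t j) - real (Xh t t j)) * f j 0 + swcost I j * real (powered_up t j)"
  have "total_cost I alg = (\<Sum>t=1..T. step_cost I alg t)"
    using total_cost_truncated[of I T alg] by (simp add: T_def truncated_horizon prefix_cost_def)
  also have "\<dots> \<le> (\<Sum>t=1..T. slot_cost I t (Xh t t) + ereal (\<Sum>j\<in>types. ?h t j))"
    by (intro sum_mono step_cost_alg_le) (simp add: T_def)
  also have "\<dots> = (\<Sum>t=1..T. slot_cost I t (Xh t t)) + (\<Sum>j\<in>types. ereal (\<Sum>t=1..T. ?h t j))"
    unfolding sum.distrib[of _ "\<lambda>t. ereal (\<Sum>j\<in>types. ?h t j)"] sum_ereal
    by (subst sum.swap) simp
  also have "\<dots> \<le> OPT T + (\<Sum>j\<in>types. 2 * OPT T)"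
  proof (intro add_mono sum_mono)
    show "(\<Sum>t=1..T. slot_cost I t (Xh t t)) \<le> OPT T"
      by (rule sum_slot_cost_le_OPT) (simp add: T_def)
    fix j assume j: "j \<in> types"
    have "ereal (\<Sum>t=1..T. ?h t j) \<le> ereal (2 * (swcost I j * real (\<Sum>u=1..T. powered_up u j)))"
      using type_overhead_le[OF j, of T] by (simp only: ereal_less_eq)
    also have "\<dots> = 2 * ereal (swcost I j * real (\<Sum>u=1..T. powered_up u j))"
      by (simp only: numeral_eq_ereal times_ereal.simps)
    also have "\<dots> \<le> 2 * OPT T"
      using swcost_powered_up_le_OPT[OF j, of T] by (intro ereal_mult_left_mono) (simp_all add: T_def)
    finally show "ereal (\<Sum>t=1..T. ?h t j) \<le> 2 * OPT T" .
  qed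
  also have "\<dots> = ereal (2 * real (num_types I) + 1) * OPT T"
    \<comment> \<open>\<open>OPT T\<close> may be infinite as an extended real; non-negativity
      excludes the value minus infinity.\<close>
    using OPT_nonneg[of T] by (cases "OPT T") (auto simp: T_def algebra_simps)
  finally show ?thesis by (simp add: T_def)
qed

end

theorem theorem8:
  fixes I :: dc_instance
    and f :: "nat \<Rightarrow> real \<Rightarrow> real"
    and Xh :: "nat \<Rightarrow> schedule"
    and Xopt :: schedule
  assumes "valid_instance I"
    and "\<And>t j z. t \<in> {1..horizon I} \<Longrightarrow> j \<in> {1..num_types I} \<Longrightarrow> z \<in> {0..zmax I j} \<Longrightarrow>
           opcost I t j z = f j z"
    and "\<And>j. j \<in> {1..num_types I} \<Longrightarrow> f j 0 > 0"
    and "\<And>t. t \<in> {1..horizon I} \<Longrightarrow> optimal (truncated I t) (Xh t)"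
    and "optimal I Xopt"
  shows "total_cost I (alg_schedule I f Xh)
         \<le> ereal (2 * real (num_types I) + 1) * total_cost I Xopt"
proof -
  interpret right_sizing I f Xh
    using assms by unfold_locales auto
  have "horizon I \<in> {1..horizon I}" using assms(1) by (auto simp: valid_instance_def)
  then have "OPT (horizon I) \<le> total_cost I Xopt"
    using assms(4)[of "horizon I"] assms(5) total_cost_truncated[of I "horizon I"]
    by (simp add: truncated_horizon optimal_def)
  then show ?thesis
    by (intro order_trans[OF alg_competitive] ereal_mult_left_mono) auto
qed

end
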